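(* Let $\{x_i\}_{i\in\{0,1,\dots,N\}}$ be the solution to the distributed-delay system (D) with continuous initial data on $[-\bar\tau,0]$, where the control $u$ is the feedback control (CD) (both described in the context). Let $$B:=\int_0^{\bar\tau}\beta(s)\,ds,\qquad R:=\max_{i\in\{0,1,\dots,N\}}\ \max_{s\in[-\bar\tau,0]}|x_i(s)|,\qquad R_\gamma:=\gamma L R+\gamma+1 .$$ If $$\bar\tau<\ln\left(1+\frac{\gamma\,\phi(2R)}{4R_\gamma B(1+\gamma)+\gamma\,\phi(2R)\,B(1+2\gamma)}\right),$$ then the solution tends towards consensus, namely there exist two constants $C,K>0$ such that $$|x_i(t)-x_0(t)|\le Ce^{-Kt}$$ for any $i\in\{1,\dots,N\}$ and $t\ge0$.
   Context: Setting. $N,d\in\mathbb{N}$, $|\cdot|$ is the Euclidean norm on $\mathbb{R}^d$, $\gamma>0$, $M>0$ are constants. The delay $\tau:[0,+\infty)\to(0,+\infty)$ is continuous and there are constants $\bar\tau,\tau_*>0$ with $\tau_*\le\tau(t)\le\bar\tau$ for all $t\ge0$. The weight $\beta:[0,\bar\tau]\to\mathbb{R}^+$ is a nonnegative integrable function with $\int_0^{\tau_*}\beta(s)\,ds>0$, and $h(t):=\int_0^{\tau(t)}\beta(s)\,ds$ for $t\ge 0$ (hence $h(t)>0$). The function $a:[0,+\infty)\to[0,+\infty)$ is continuous and non-increasing, with $a(s)=1$ for $s\in[0,\delta]$ and $a(s)=0$ for $s\ge r$, where $r>\delta>0$. The function $\phi:[0,+\infty)\to(0,+\infty)$ is non-increasing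 and Lipschitz continuous with Lipschitz constant $L>0$, and $\phi(0)=1$. System (D): $x_0$ (leader) and $x_1,\dots,x_N$ (agents) are $\mathbb{R}^d$-valued functions with, for $t\ge0$ and $i=1,\dots,N$, $$\frac{dx_0}{dt}(t)=u(t),$$ $$\frac{dx_i}{dt}(t)=\frac1{N h(t)}\sum_{j\in\{1,\dots,N\},\,j\ne i}\int_{t-\tau(t)}^t\beta(t-s)\,a_{ij}(t;s)\,(x_j(s)-x_i(t))\,ds+\frac{\gamma}{h(t)}\int_{t-\tau(t)}^t\beta(t-s)\,\phi(|x_0(s)-x_i(t)|)\,(x_0(s)-x_i(t))\,ds,$$ where $a_{ij}(t;s)=a(|x_j(s)-x_i(t)|)$, and with prescribed continuous initial data $x_i(s)=x_{i,0}(s)$, $s\in[-\bar\tau,0]$, $i=0,1,\dots,N$. A solution consists of continuous functions on $[-\bar\tau,+\infty)$, locally absolutely continuous on $[0,+\infty)$, satisfying the equations for almost every $t\ge0$. Control (CD): for each $t\ge0$ let $p=p(t)\in\{1,\dots,N\}$ be an index with $|x_p(t)-x_0(t)|=\max_{i\in\{1,\dots,N\}}|x_i(t)-x_0(t)|$; then $$u(t)=\frac{\gamma}{h(t)}\int_{t-\tau(t)}^t\beta(t-s)\,\alpha(t;s)\sum_{j=1}^N\phi(|x_j(s)-x_0(t)|)\,(x_j(s)-x_0(t))\,ds,$$ $$\alpha(t;s)=\frac12\min\left\{\frac{\phi(|x_{p(t)}(s)-x_0(t)|)}{N},\ \frac{2M}{\gamma\sum_{j=1}^N|x_j(s)-x_0(t)|}\right\},\quad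 s\in[t-\tau(t),t],$$ the second entry of the minimum being read as $+\infty$ when its denominator vanishes. *)

theory Defs
  imports "HOL-Analysis.Analysis"
begin

definition abs_continuous_on_interval :: "real \<Rightarrow> real \<Rightarrow> (real \<Rightarrow> 'a::metric_space) \<Rightarrow> bool" where
  "abs_continuous_on_interval a b f \<longleftrightarrow>
     (\<forall>\<epsilon>>0. \<exists>\<eta>>0. \<forall>(n::nat) (v :: nat \<Rightarrow> real) (w :: nat \<Rightarrow> real).
        (\<forall>k<n. a \<le> v k \<and> v k \<le> w k \<and> w k \<le> b) \<and>
        disjoint_family_on (\<lambda>k. {v k<..<w k}) {..<n} \<and>
        (\<Sum>k<n. w k - v k) < \<eta>
        \<longrightarrow> (\<Sum>k<n. dist (f (v k)) (f (w k))) < \<epsilon>)"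

definition locally_abs_continuous_on :: "real set \<Rightarrow> (real \<Rightarrow> 'a::metric_space) \<Rightarrow> bool" where
  "locally_abs_continuous_on S f \<longleftrightarrow>
     (\<forall>a b. a \<le> b \<and> {a..b} \<subseteq> S \<longrightarrow> abs_continuous_on_interval a b f)"

definition delay_mass :: "(real \<Rightarrow> real) \<Rightarrow> (real \<Rightarrow> real) \<Rightarrow> real \<Rightarrow> real" where
  "delay_mass \<tau> \<beta> t = integral {0..\<tau> t} \<beta>"

text \<open>Index 0 is the leader, indices 1 to N are the agents. The trajectories are total
  functions of time; only their values on [-taubar, infinity) are used.\<close>

definition agent_rhs ::
  "nat \<Rightarrow> real \<Rightarrow> (real \<Rightarrow> real) \<Rightarrow> (real \<Rightarrow> real) \<Rightarrow> (real \<Rightarrow> real) \<Rightarrow> (real \<Rightarrow> real)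
   \<Rightarrow> (nat \<Rightarrow> real \<Rightarrow> real^'d) \<Rightarrow> nat \<Rightarrow> real \<Rightarrow> real^'d" where
  "agent_rhs N \<gamma> \<tau> \<beta> a \<phi> x i t =
     (1 / (real N * delay_mass \<tau> \<beta> t)) *\<^sub>R
       (\<Sum>j\<in>{1..N} - {i}. integral {t - \<tau> t..t}
          (\<lambda>s. (\<beta> (t - s) * a (norm (x j s - x i t))) *\<^sub>R (x j s - x i t)))
   + (\<gamma> / delay_mass \<tau> \<beta> t) *\<^sub>R
       integral {t - \<tau> t..t}
          (\<lambda>s. (\<beta> (t - s) * \<phi> (norm (x 0 s - x i t))) *\<^sub>R (x 0 s - x i t))"

definition is_solution_D ::
  "nat \<Rightarrow> real \<Rightarrow> (real \<Rightarrow> real) \<Rightarrow> real \<Rightarrow> (real \<Rightarrow> real) \<Rightarrow> (real \<Rightarrow> real) \<Rightarrow> (real \<Rightarrow> real)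
   \<Rightarrow> (nat \<Rightarrow> real \<Rightarrow> real^'d) \<Rightarrow> (real \<Rightarrow> real^'d) \<Rightarrow> (nat \<Rightarrow> real \<Rightarrow> real^'d) \<Rightarrow> bool" where
  "is_solution_D N \<gamma> \<tau> taubar \<beta> a \<phi> xinit u x \<longleftrightarrow>
     (\<forall>i\<in>{0..N}. continuous_on {-taubar..} (x i) \<and>
                 locally_abs_continuous_on {0..} (x i) \<and>
                 (\<forall>s\<in>{-taubar..0}. x i s = xinit i s)) \<and>
     (AE t in lebesgue. t \<ge> 0 \<longrightarrow>
        (x 0 has_vector_derivative u t) (at t) \<and>
        (\<forall>i\<in>{1..N}. (x i has_vector_derivative agent_rhs N \<gamma> \<tau> \<beta> a \<phi> x i t) (at t)))"

text \<open>The conditional implements the convention that the second entry of the minimum is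
  infinite when its denominator vanishes.\<close>

definition control_weight ::
  "nat \<Rightarrow> real \<Rightarrow> real \<Rightarrow> (real \<Rightarrow> real) \<Rightarrow> (nat \<Rightarrow> real \<Rightarrow> real^'d) \<Rightarrow> (real \<Rightarrow> nat)
   \<Rightarrow> real \<Rightarrow> real \<Rightarrow> real" where
  "control_weight N \<gamma> M \<phi> x p t s =
     (let first = \<phi> (norm (x (p t) s - x 0 t)) / real N;
          D = \<gamma> * (\<Sum>j=1..N. norm (x j s - x 0 t))
      in 1/2 * (if D = 0 then first else min first (2 * M / D)))"

definition feedback_control ::
  "nat \<Rightarrow> real \<Rightarrow> real \<Rightarrow> (real \<Rightarrow> real) \<Rightarrow> (real \<Rightarrow> real) \<Rightarrow> (real \<Rightarrow> real)
   \<Rightarrow> (nat \<Rightarrow> real \<Rightarrow> real^'d) \<Rightarrow> (real \<Rightarrow> nat) \<Rightarrow> real \<Rightarrow> real^'d" where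
  "feedback_control N \<gamma> M \<tau> \<beta> \<phi> x p t =
     (\<gamma> / delay_mass \<tau> \<beta> t) *\<^sub>R
       integral {t - \<tau> t..t}
         (\<lambda>s. (\<beta> (t - s) * control_weight N \<gamma> M \<phi> x p t s) *\<^sub>R
              (\<Sum>j=1..N. \<phi> (norm (x j s - x 0 t)) *\<^sub>R (x j s - x 0 t)))"

definition farthest_agent_selection ::
  "nat \<Rightarrow> (nat \<Rightarrow> real \<Rightarrow> real^'d) \<Rightarrow> (real \<Rightarrow> nat) \<Rightarrow> bool" where
  "farthest_agent_selection N x p \<longleftrightarrow>
     (\<forall>t\<ge>0. p t \<in> {1..N} \<and>
        norm (x (p t) t - x 0 t) = (MAX i\<in>{1..N}. norm (x i t - x 0 t)))"

end

theory Submission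
  imports Defs
begin

text \<open>
  Every right-hand side is a weighted sum of differences \<open>x\<^sub>j(s) - x\<^sub>i(t)\<close> with \<open>s\<close> in the
  delay window before \<open>t\<close>, nonnegative weights and total weight at most \<open>K = 1 + \<gamma>\<close>. Each
  position is therefore attracted by past positions only, and the convex hull of all positions
  occupied during one window of length \<open>T\<close>, the upper bound of the delay, is never left again. The
  leader moreover acts on every agent with total weight at least \<open>\<gamma> \<phi>(2R)\<close>, for a bound \<open>R\<close> of
  all trajectories, while the agents may be invisible to each other. This one-way influence already
  forces the hull to shrink.

  Both facts are tested in one direction \<open>v\<close> at a time. Suppose that over one window all
  projections \<open>v \<bullet> x\<^sub>j\<close> lie in an interval \<open>[m, m + \<Delta>]\<close>. At the end of the window the leader is in
  one of the two halves, say in the lower one. The gap \<open>m + \<Delta> - v \<bullet> x\<^sub>0\<close> decays at rate at most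
  \<open>K\<close>, so it stays at least a fixed fraction of \<open>\<Delta>\<close> during the next three windows. After the first
  of these the agents only remember such leader positions, and during the second their pull keeps
  each agent a fixed fraction of \<open>\<Delta>\<close> below \<open>m + \<Delta>\<close>; the third is then a window in which all
  projections lie in a shorter interval (\<open>leader_gap_spreads\<close>, \<open>spread_contracts\<close>). The fraction
  depends neither on \<open>v\<close> nor on the starting time, so the width decays geometrically, and taking
  \<open>v\<close> along \<open>x\<^sub>i(t) - x\<^sub>0(t)\<close> bounds the distance itself (\<open>exponential_consensus\<close>).

  The equations hold almost everywhere only, so every comparison over time rests on one analytic
  fact: an absolutely continuous
  function whose derivative is nonnegative almost everywhere is nondecreasing
  (\<open>abs_continuous_mono_if_deriv_nonneg_AE\<close>).
\<close>

section \<open>Absolutely continuous functions with a one-sided derivative bound\<close>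

text \<open>
  The term \<open>w - v\<close> lets \<open>F\<close> depend on time as well; this covers products of \<open>f\<close> with smooth
  functions of time.
\<close>

lemma abs_continuous_on_interval_dominated:
  fixes f :: "real \<Rightarrow> 'a::metric_space" and F :: "real \<Rightarrow> 'b::metric_space"
  assumes f: "abs_continuous_on_interval a b f"
    and dom: "\<And>v w. a \<le> v \<Longrightarrow> v \<le> w \<Longrightarrow> w \<le> b \<Longrightarrow> dist (F v) (F w) \<le> C * (dist (f v) (f w) + (w - v))"
  shows "abs_continuous_on_interval a b F"
  unfolding abs_continuous_on_interval_def
proof (intro allI impI)
  fix \<epsilon> :: real assume "\<epsilon> > 0"
  define e where "e = \<epsilon> / (2 * (\<bar>C\<bar> + 1))"
  have "e > 0" using \<open>\<epsilon> > 0\<close> by (simp add: e_def add_nonneg_pos)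
  then obtain \<eta> where "\<eta> > 0" and \<eta>: "\<And>(n::nat) v w.
        (\<forall>k<n. a \<le> v k \<and> v k \<le> w k \<and> w k \<le> b) \<and>
        disjoint_family_on (\<lambda>k. {v k<..<w k}) {..<n} \<and> (\<Sum>k<n. w k - v k) < \<eta>
        \<Longrightarrow> (\<Sum>k<n. dist (f (v k)) (f (w k))) < e"
    using f unfolding abs_continuous_on_interval_def by meson
  have "(\<Sum>k<n. dist (F (v k)) (F (w k))) < \<epsilon>"
    if A: "(\<forall>k<n. a \<le> v k \<and> v k \<le> w k \<and> w k \<le> b) \<and>
        disjoint_family_on (\<lambda>k. {v k<..<w k}) {..<n} \<and> (\<Sum>k<n. w k - v k) < min \<eta> e"
    for n :: nat and v w
  proof -
    have f_small: "(\<Sum>k<n. dist (f (v k)) (f (w k))) < e" using \<eta>[of n v w] A by simp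
    have "(\<Sum>k<n. dist (F (v k)) (F (w k))) \<le> (\<Sum>k<n. (\<bar>C\<bar> + 1) * (dist (f (v k)) (f (w k)) + (w k - v k)))"
    proof (rule sum_mono)
      fix k assume "k \<in> {..<n}"
      then have k: "a \<le> v k" "v k \<le> w k" "w k \<le> b" using A by auto
      have "C * (dist (f (v k)) (f (w k)) + (w k - v k)) \<le> (\<bar>C\<bar> + 1) * (dist (f (v k)) (f (w k)) + (w k - v k))"
        using k by (intro mult_right_mono) auto
      with dom[OF k] show "dist (F (v k)) (F (w k)) \<le> (\<bar>C\<bar> + 1) * (dist (f (v k)) (f (w k)) + (w k - v k))"
        by linarith
    qed
    also have "\<dots> = (\<bar>C\<bar> + 1) * ((\<Sum>k<n. dist (f (v k)) (f (w k))) + (\<Sum>k<n. w k - v k))"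
      unfolding sum.distrib[symmetric] by (rule sum_distrib_left[symmetric])
    also have "\<dots> < (\<bar>C\<bar> + 1) * (2 * e)"
      using f_small A by (intro mult_strict_left_mono) auto
    also have "\<dots> = \<epsilon>"
      using abs_ge_zero[of C] unfolding e_def by (simp add: field_simps add_nonneg_eq_0_iff)
    finally show ?thesis .
  qed
  then show "\<exists>\<eta>>0. \<forall>(n::nat) v w. (\<forall>k<n. a \<le> v k \<and> v k \<le> w k \<and> w k \<le> b) \<and>
        disjoint_family_on (\<lambda>k. {v k<..<w k}) {..<n} \<and> (\<Sum>k<n. w k - v k) < \<eta>
        \<longrightarrow> (\<Sum>k<n. dist (F (v k)) (F (w k))) < \<epsilon>"
    using \<open>\<eta> > 0\<close> \<open>e > 0\<close> by (intro exI[of _ "min \<eta> e"]) auto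
qed

text \<open>
  The definition counts intervals by natural numbers. Tagged divisions are sets, so their cells
  have to be admitted as indices.
\<close>

lemma abs_continuous_on_interval_family:
  assumes f: "abs_continuous_on_interval a b f" and "\<epsilon> > 0"
  shows "\<exists>\<eta>>0. \<forall>P. finite P \<and> (\<forall>q\<in>P. a \<le> v q \<and> v q \<le> w q \<and> w q \<le> b) \<and>
      disjoint_family_on (\<lambda>q. {v q<..<w q}) P \<and> (\<Sum>q\<in>P. w q - v q) < \<eta>
      \<longrightarrow> (\<Sum>q\<in>P. dist (f (v q)) (f (w q))) < \<epsilon>"
proof -
  obtain \<eta> where "\<eta> > 0" and \<eta>: "\<And>(n::nat) v w.
        (\<forall>k<n. a \<le> v k \<and> v k \<le> w k \<and> w k \<le> b) \<and>
        disjoint_family_on (\<lambda>k. {v k<..<w k}) {..<n} \<and> (\<Sum>k<n. w k - v k) < \<eta>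
        \<Longrightarrow> (\<Sum>k<n. dist (f (v k)) (f (w k))) < \<epsilon>"
    using f \<open>\<epsilon> > 0\<close> unfolding abs_continuous_on_interval_def by meson
  have "(\<Sum>q\<in>P. dist (f (v q)) (f (w q))) < \<epsilon>"
    if "finite P" and bounds: "\<forall>q\<in>P. a \<le> v q \<and> v q \<le> w q \<and> w q \<le> b"
      and disj: "disjoint_family_on (\<lambda>q. {v q<..<w q}) P" and len: "(\<Sum>q\<in>P. w q - v q) < \<eta>" for P
  proof -
    obtain e where e: "bij_betw e {..<card P} P"
      using ex_bij_betw_nat_finite[OF \<open>finite P\<close>] by (auto simp: atLeast0LessThan)
    have "\<forall>k<card P. a \<le> v (e k) \<and> v (e k) \<le> w (e k) \<and> w (e k) \<le> b"
      using bounds bij_betwE[OF e] by auto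
    moreover have "disjoint_family_on (\<lambda>k. {v (e k)<..<w (e k)}) {..<card P}"
      unfolding disjoint_family_on_def
    proof (intro ballI impI)
      fix k l assume "k \<in> {..<card P}" "l \<in> {..<card P}" "k \<noteq> l"
      then have "e k \<in> P" "e l \<in> P" "e k \<noteq> e l"
        using e by (auto simp: bij_betw_def inj_on_def)
      then show "{v (e k)<..<w (e k)} \<inter> {v (e l)<..<w (e l)} = {}"
        using disj unfolding disjoint_family_on_def by blast
    qed
    moreover have "(\<Sum>k<card P. w (e k) - v (e k)) < \<eta>"
      using len sum.reindex_bij_betw[OF e, of "\<lambda>q. w q - v q"] by simp
    ultimately have "(\<Sum>k<card P. dist (f (v (e k))) (f (w (e k)))) < \<epsilon>"
      using \<eta>[of "card P" "v \<circ> e" "w \<circ> e"] by simp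
    then show ?thesis
      using sum.reindex_bij_betw[OF e, of "\<lambda>q. dist (f (v q)) (f (w q))"] by simp
  qed
  with \<open>\<eta> > 0\<close> show ?thesis by blast
qed

text \<open>
  Intervals that contain \<open>t\<close> need not have it as an endpoint. Splitting them at \<open>t\<close> costs nothing,
  since the two error terms add up to \<open>\<epsilon>\<close> times the full length.
\<close>

lemma derivative_nonneg_straddle:
  fixes F :: "real \<Rightarrow> real"
  assumes "(F has_real_derivative D) (at t)" "D \<ge> 0" "\<epsilon> > 0"
  obtains d where "d > 0"
    "\<And>y z. y \<le> t \<Longrightarrow> t \<le> z \<Longrightarrow> y \<in> ball t d \<Longrightarrow> z \<in> ball t d \<Longrightarrow> F y - F z \<le> \<epsilon> * (z - y)"
proof -
  obtain d where "d > 0" and d: "\<And>y. norm (y - t) < d \<Longrightarrow> norm (F y - F t - D * (y - t)) \<le> \<epsilon> * norm (y - t)"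
    using assms unfolding has_field_derivative_def has_derivative_at_alt by metis
  have "F y - F z \<le> \<epsilon> * (z - y)" if "y \<le> t" "t \<le> z" "y \<in> ball t d" "z \<in> ball t d" for y z
  proof -
    have "F y - F t - D * (y - t) \<le> \<epsilon> * (t - y)" "- (F z - F t - D * (z - t)) \<le> \<epsilon> * (z - t)"
      using d[of y] d[of z] that by (auto simp: dist_real_def abs_le_iff)
    moreover have "D * (y - t) \<le> D * (z - t)" using that \<open>D \<ge> 0\<close> by (intro mult_left_mono) auto
    ultimately show ?thesis by (simp add: algebra_simps)
  qed
  with \<open>d > 0\<close> that show ?thesis by blast
qed

lemma disjoint_intervals_length_le:
  fixes v w :: "'i \<Rightarrow> real"
  assumes "finite P" "\<And>q. q \<in> P \<Longrightarrow> v q \<le> w q" "disjoint_family_on (\<lambda>q. {v q<..<w q}) P"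
    and "\<And>q. q \<in> P \<Longrightarrow> {v q<..<w q} \<subseteq> G" "G \<in> lmeasurable"
  shows "(\<Sum>q\<in>P. w q - v q) \<le> measure lebesgue G"
proof -
  have "(\<Sum>q\<in>P. w q - v q) = (\<Sum>q\<in>P. measure lebesgue {v q<..<w q})"
    using assms(2) by (intro sum.cong) auto
  also have "\<dots> = measure lebesgue (\<Union>q\<in>P. {v q<..<w q})"
    using assms(1-3)
    by (intro measure_finite_Union[symmetric]) (auto simp: emeasure_lborel_Ioo)
  also have "\<dots> \<le> measure lebesgue G"
    using assms(1,4,5) by (intro measure_mono_fmeasurable) (auto intro!: sets.finite_UN)
  finally show ?thesis .
qed

text \<open>
  Choose a gauge that on the good points is small enough for the straddle estimate and that on
  the exceptional null set \<open>E\<close> stays inside an open set \<open>G \<supseteq> E\<close> of tiny measure. In a division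
  fine for this gauge the cells with good tags contribute a decrease of at most
  \<open>\<epsilon> (b - a)\<close>. The cells with tags in \<open>E\<close> have total length below the measure of \<open>G\<close>, so by
  absolute continuity they contribute at most \<open>\<epsilon>\<close>.
\<close>

lemma abs_continuous_mono_if_deriv_nonneg_AE:
  fixes F :: "real \<Rightarrow> real"
  assumes "a \<le> b" and AC: "abs_continuous_on_interval a b F"
    and deriv: "AE t in lebesgue. t \<in> {a..b} \<longrightarrow> (\<exists>D\<ge>0. (F has_real_derivative D) (at t))"
  shows "F a \<le> F b"
proof (rule field_le_epsilon)
  fix e :: real assume "e > 0"
  define \<epsilon> where "\<epsilon> = e / (b - a + 1)"
  have "\<epsilon> > 0" using \<open>e > 0\<close> \<open>a \<le> b\<close> by (simp add: \<epsilon>_def)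
  obtain E where E: "E \<in> null_sets lebesgue"
    "\<And>t. t \<in> {a..b} \<Longrightarrow> t \<notin> E \<Longrightarrow> \<exists>D\<ge>0. (F has_real_derivative D) (at t)"
    using AE_E3[OF deriv] by (metis (no_types, lifting) DiffI UNIV_I space_completion space_lborel space_borel)
  obtain \<eta> where "\<eta> > 0" and \<eta>: "\<forall>P :: (real \<times> real set) set. finite P \<and>
      (\<forall>q\<in>P. a \<le> Inf (snd q) \<and> Inf (snd q) \<le> Sup (snd q) \<and> Sup (snd q) \<le> b) \<and>
      disjoint_family_on (\<lambda>q. {Inf (snd q)<..<Sup (snd q)}) P \<and> (\<Sum>q\<in>P. Sup (snd q) - Inf (snd q)) < \<eta>
      \<longrightarrow> (\<Sum>q\<in>P. dist (F (Inf (snd q))) (F (Sup (snd q)))) < \<epsilon>"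
    using abs_continuous_on_interval_family[OF AC \<open>\<epsilon> > 0\<close>, where v="\<lambda>q::real \<times> real set. Inf (snd q)"
        and w="\<lambda>q. Sup (snd q)"] by blast
  obtain G where G: "open G" "E \<subseteq> G" "G - E \<in> lmeasurable" "emeasure lebesgue (G - E) < ennreal \<eta>"
    using sets_lebesgue_outer_open[OF null_setsD2[OF E(1)] \<open>\<eta> > 0\<close>] by metis
  have G_split: "G = (G - E) \<union> E" using G(2) by blast
  have "emeasure lebesgue ((G - E) \<union> E) = emeasure lebesgue (G - E)"
    using G(3) E(1) by (intro emeasure_Un_null_set) auto
  then have emG: "emeasure lebesgue G < ennreal \<eta>" using G(4) G_split by metis
  then have Gm: "G \<in> lmeasurable" using G(1) 
    by (intro fmeasurableI) (auto simp: less_top[symmetric] intro: order.strict_trans)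
  have mG: "measure lebesgue G < \<eta>"
    using emG emeasure_eq_measure2[OF Gm] \<open>\<eta> > 0\<close> by (simp add: ennreal_less_iff)
  have "\<exists>d>0. (t \<in> E \<longrightarrow> ball t d \<subseteq> G) \<and> (t \<in> {a..b} - E \<longrightarrow>
       (\<forall>y z. y \<le> t \<longrightarrow> t \<le> z \<longrightarrow> y \<in> ball t d \<longrightarrow> z \<in> ball t d \<longrightarrow> F y - F z \<le> \<epsilon> * (z - y)))" for t
  proof (cases "t \<in> E")
    case True
    then show ?thesis using G(1,2) by (auto simp: open_contains_ball)
  next
    case False
    show ?thesis
    proof (cases "t \<in> {a..b}")
      case True
      then obtain D where "D \<ge> 0" "(F has_real_derivative D) (at t)" using E(2) False by blast
      with derivative_nonneg_straddle[OF this(2,1) \<open>\<epsilon> > 0\<close>] False show ?thesis by metis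
    qed (use False in \<open>auto intro: exI[of _ 1]\<close>)
  qed
  then obtain d where d: "\<And>t. d t > 0" "\<And>t. t \<in> E \<Longrightarrow> ball t (d t) \<subseteq> G"
    "\<And>t y z. t \<in> {a..b} - E \<Longrightarrow> y \<le> t \<Longrightarrow> t \<le> z \<Longrightarrow> y \<in> ball t (d t) \<Longrightarrow> z \<in> ball t (d t)
       \<Longrightarrow> F y - F z \<le> \<epsilon> * (z - y)"
    by metis
  have "gauge (\<lambda>t. ball t (d t))" using d(1) by (intro gauge_ball_dependent) auto
  then obtain p where p: "p tagged_division_of {a..b}" "(\<lambda>t. ball t (d t)) fine p"
    by (rule fine_division_exists_real)
  have cell: "a \<le> Inf K \<and> Inf K \<le> t \<and> t \<le> Sup K \<and> Sup K \<le> b \<and> K = {Inf K..Sup K} \<and> K \<subseteq> ball t (d t)"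
    if q: "(t, K) \<in> p" for t K
  proof -
    obtain v w where K: "K = {v..w}" using tagged_division_ofD(4)[OF p(1) q] by auto
    have t: "t \<in> K" "K \<subseteq> {a..b}" using tagged_division_ofD(2,3)[OF p(1) q] by auto
    then have "v \<le> w" using K by auto
    then show ?thesis using K t fineD[OF p(2) q] by auto
  qed
  have finp: "finite p" using p(1) by blast
  define P where "P = {q \<in> p. fst q \<in> E}"
  have P: "finite P" using finp by (simp add: P_def)
  have P_disj: "disjoint_family_on (\<lambda>q. {Inf (snd q)<..<Sup (snd q)}) P"
    unfolding disjoint_family_on_def
  proof (intro ballI impI)
    fix q q' assume q: "q \<in> P" "q' \<in> P" "q \<noteq> q'"
    have "interior (snd q) \<inter> interior (snd q') = {}"
      using tagged_division_ofD(5)[OF p(1), of "fst q" "snd q" "fst q'" "snd q'"] q by (simp add: P_def)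
    moreover have "interior (snd q) = {Inf (snd q)<..<Sup (snd q)}" if "q \<in> P" for q
      using cell[of "fst q" "snd q"] that interior_atLeastAtMost_real by (metis (no_types, lifting) P_def mem_Collect_eq prod.collapse)
    ultimately show "{Inf (snd q)<..<Sup (snd q)} \<inter> {Inf (snd q')<..<Sup (snd q')} = {}"
      using q by simp
  qed
  have P_cell: "a \<le> Inf (snd q) \<and> Inf (snd q) \<le> Sup (snd q) \<and> Sup (snd q) \<le> b
      \<and> {Inf (snd q)<..<Sup (snd q)} \<subseteq> G" if "q \<in> P" for q
  proof -
    have q: "(fst q, snd q) \<in> p" "fst q \<in> E" using that by (auto simp: P_def)
    have "{Inf (snd q)<..<Sup (snd q)} \<subseteq> snd q" 
      using cell[OF q(1)] greaterThanLessThan_subseteq_atLeastAtMost_iff by (metis order_refl)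
    then show ?thesis using cell[OF q(1)] d(2)[OF q(2)] by force
  qed
  have "(\<Sum>q\<in>P. Sup (snd q) - Inf (snd q)) \<le> measure lebesgue G"
    using P P_disj P_cell Gm by (intro disjoint_intervals_length_le) auto
  then have "(\<Sum>q\<in>P. dist (F (Inf (snd q))) (F (Sup (snd q)))) < \<epsilon>"
    using mG P P_disj P_cell by (intro \<eta>[rule_format]) auto
  moreover have "(\<Sum>q\<in>P. F (Inf (snd q)) - F (Sup (snd q))) \<le> (\<Sum>q\<in>P. dist (F (Inf (snd q))) (F (Sup (snd q))))"
    by (intro sum_mono) (auto simp: dist_real_def)
  ultimately have bad: "(\<Sum>q\<in>P. F (Inf (snd q)) - F (Sup (snd q))) \<le> \<epsilon>" by linarith
  have tele: "(\<Sum>q\<in>p. f (Sup (snd q)) - f (Inf (snd q))) = f b - f a" for f :: "real \<Rightarrow> real"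
    using additive_tagged_division_1[OF \<open>a \<le> b\<close> p(1), of f] by (simp add: case_prod_beta)
  have "(\<Sum>q\<in>p - P. F (Inf (snd q)) - F (Sup (snd q))) \<le> (\<Sum>q\<in>p - P. \<epsilon> * (Sup (snd q) - Inf (snd q)))"
  proof (rule sum_mono)
    fix q assume "q \<in> p - P"
    then have q: "(fst q, snd q) \<in> p" "fst q \<notin> E" by (auto simp: P_def)
    have "Inf (snd q) \<in> snd q" "Sup (snd q) \<in> snd q"
      using cell[OF q(1)] by (metis atLeastAtMost_iff order_trans order_refl)+
    then show "F (Inf (snd q)) - F (Sup (snd q)) \<le> \<epsilon> * (Sup (snd q) - Inf (snd q))"
      using cell[OF q(1)] q(2) by (intro d(3)[of "fst q"]) auto
  qed
  also have "\<dots> \<le> (\<Sum>q\<in>p. \<epsilon> * (Sup (snd q) - Inf (snd q)))"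
  proof (rule sum_mono2[OF finp])
    fix q assume "q \<in> p - (p - P)"
    then have "(fst q, snd q) \<in> p" by auto
    from cell[OF this] show "0 \<le> \<epsilon> * (Sup (snd q) - Inf (snd q))" using \<open>\<epsilon> > 0\<close> by auto
  qed auto
  also have "\<dots> = \<epsilon> * (b - a)" using tele[of "\<lambda>t. t"] by (simp add: sum_distrib_left[symmetric])
  finally have good: "(\<Sum>q\<in>p - P. F (Inf (snd q)) - F (Sup (snd q))) \<le> \<epsilon> * (b - a)" .
  have "F a - F b = (\<Sum>q\<in>p. F (Inf (snd q)) - F (Sup (snd q)))"
    using tele[of "\<lambda>t. - F t"] by simp
  also have "\<dots> = (\<Sum>q\<in>p - P. F (Inf (snd q)) - F (Sup (snd q))) + (\<Sum>q\<in>P. F (Inf (snd q)) - F (Sup (snd q)))"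
    by (rule sum.subset_diff) (use finp in \<open>auto simp: P_def\<close>)
  also have "\<dots> \<le> \<epsilon> * (b - a + 1)" using good bad by (simp add: algebra_simps)
  also have "\<dots> = e" using \<open>a \<le> b\<close> by (simp add: \<epsilon>_def)
  finally show "F a \<le> F b + e" by simp
qed

text \<open>
  The bound says that \<open>exp (K t) (q - v \<bullet> y t)\<close> has a nonnegative derivative almost everywhere.
\<close>

lemma exponential_comparison_AE:
  fixes y :: "real \<Rightarrow> 'a::real_inner"
  assumes "a \<le> b" "K > 0" and AC: "abs_continuous_on_interval a b y" and cont: "continuous_on {a..b} y"
    and deriv: "AE t in lebesgue. t \<in> {a..b} \<longrightarrow>
        (\<exists>D. (y has_vector_derivative D) (at t) \<and> v \<bullet> D \<le> K * (q - v \<bullet> y t))"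
  shows "exp (- K * (b - a)) * (q - v \<bullet> y a) \<le> q - v \<bullet> y b"
proof -
  define F where "F = (\<lambda>t. exp (K * (t - a)) * (q - v \<bullet> y t))"
  have "bounded (y ` {a..b})"
    using cont compact_continuous_image compact_imp_bounded by blast
  then obtain C where "\<forall>z\<in>y ` {a..b}. norm z \<le> C"
    unfolding bounded_iff by blast
  then have C: "norm (y t) \<le> C" if "t \<in> {a..b}" for t
    using that by blast
  define Q where "Q = \<bar>q\<bar> + norm v * C"
  have Q: "\<bar>q - v \<bullet> y t\<bar> \<le> Q" if "t \<in> {a..b}" for t
  proof -
    have "\<bar>v \<bullet> y t\<bar> \<le> norm v * C"
      using Cauchy_Schwarz_ineq2[of v "y t"] mult_left_mono[OF C[OF that], of "norm v"] by auto
    then show ?thesis unfolding Q_def by linarith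
  qed
  then have "Q \<ge> 0" using \<open>a \<le> b\<close> by (meson abs_ge_zero atLeastAtMost_iff order_refl order_trans)
  define E where "E = exp (K * (b - a))"
  have E: "exp (K * (t - a)) \<le> E" if "t \<le> b" for t
    using that \<open>K > 0\<close> by (simp add: E_def)
  have "E > 0" by (simp add: E_def)
  have "abs_continuous_on_interval a b F"
  proof (rule abs_continuous_on_interval_dominated[OF AC])
    fix s t assume st: "a \<le> s" "s \<le> t" "t \<le> b"
    have exp_lip: "\<bar>exp (K * (t - a)) - exp (K * (s - a))\<bar> \<le> E * K * (t - s)"
    proof -
      have "exp (K * (s - a)) = exp (K * (t - a)) * exp (- (K * (t - s)))"
        by (simp add: exp_add[symmetric] algebra_simps)
      moreover have "1 - K * (t - s) \<le> exp (- (K * (t - s)))"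
        using exp_ge_add_one_self[of "- (K * (t - s))"] by simp
      ultimately have "exp (K * (t - a)) * (1 - K * (t - s)) \<le> exp (K * (s - a))"
        by (metis exp_ge_zero mult_left_mono)
      then have "exp (K * (t - a)) - exp (K * (s - a)) \<le> exp (K * (t - a)) * (K * (t - s))"
        by (simp add: algebra_simps)
      also have "\<dots> \<le> E * (K * (t - s))"
        using E[of t] st \<open>K > 0\<close> by (intro mult_right_mono) auto
      finally have "exp (K * (t - a)) - exp (K * (s - a)) \<le> E * K * (t - s)" by (simp add: mult.assoc)
      moreover have "exp (K * (s - a)) \<le> exp (K * (t - a))" using st \<open>K > 0\<close> by simp
      ultimately show ?thesis by linarith
    qed
    have "F s - F t = exp (K * (s - a)) * (v \<bullet> (y t - y s)) - (exp (K * (t - a)) - exp (K * (s - a))) * (q - v \<bullet> y t)"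
      by (simp add: F_def inner_diff_right algebra_simps)
    then have "dist (F s) (F t) \<le> \<bar>exp (K * (s - a)) * (v \<bullet> (y t - y s))\<bar>
        + \<bar>(exp (K * (t - a)) - exp (K * (s - a))) * (q - v \<bullet> y t)\<bar>"
      unfolding dist_real_def by linarith
    also have "\<dots> = exp (K * (s - a)) * \<bar>v \<bullet> (y t - y s)\<bar>
        + \<bar>exp (K * (t - a)) - exp (K * (s - a))\<bar> * \<bar>q - v \<bullet> y t\<bar>"
      by (simp add: abs_mult)
    also have "\<dots> \<le> E * (norm v * dist (y s) (y t)) + E * K * (t - s) * Q"
      using Cauchy_Schwarz_ineq2[of v "y t - y s"] E[of s] exp_lip Q[of t] st \<open>E > 0\<close> \<open>K > 0\<close>
      by (intro add_mono mult_mono) (auto simp: dist_norm norm_minus_commute)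
    also have "\<dots> \<le> (E * norm v + E * K * Q) * (dist (y s) (y t) + (t - s))"
    proof -
      have "0 \<le> E * norm v * (t - s) + E * K * Q * dist (y s) (y t)"
        using st \<open>E > 0\<close> \<open>K > 0\<close> \<open>Q \<ge> 0\<close> by simp
      then show ?thesis by (simp add: algebra_simps)
    qed
    finally show "dist (F s) (F t) \<le> (E * norm v + E * K * Q) * (dist (y s) (y t) + (t - s))" .
  qed
  moreover have "AE t in lebesgue. t \<in> {a..b} \<longrightarrow> (\<exists>D\<ge>0. (F has_real_derivative D) (at t))"
    using deriv
  proof (eventually_elim, intro impI)
    fix t assume *: "t \<in> {a..b} \<longrightarrow>
        (\<exists>D. (y has_vector_derivative D) (at t) \<and> v \<bullet> D \<le> K * (q - v \<bullet> y t))" "t \<in> {a..b}"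
    then obtain D where D: "(y has_vector_derivative D) (at t)" "v \<bullet> D \<le> K * (q - v \<bullet> y t)" by blast
    have "((\<lambda>t. v \<bullet> y t) has_vector_derivative v \<bullet> D) (at t)"
      by (rule bounded_linear.has_vector_derivative[OF bounded_linear_inner_right D(1)])
    then have [derivative_intros]: "((\<lambda>t. v \<bullet> y t) has_real_derivative v \<bullet> D) (at t)"
      by (simp add: has_real_derivative_iff_has_vector_derivative)
    have "(F has_real_derivative exp (K * (t - a)) * (K * (q - v \<bullet> y t) - v \<bullet> D)) (at t)"
      unfolding F_def by (auto intro!: derivative_eq_intros simp: algebra_simps)
    moreover have "exp (K * (t - a)) * (K * (q - v \<bullet> y t) - v \<bullet> D) \<ge> 0" using D(2) by simp
    ultimately show "\<exists>D\<ge>0. (F has_real_derivative D) (at t)" by blast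
  qed
  ultimately have "F a \<le> F b" using \<open>a \<le> b\<close> abs_continuous_mono_if_deriv_nonneg_AE by blast
  then have "exp (- K * (b - a)) * F a \<le> exp (- K * (b - a)) * F b" by simp
  also have "exp (- K * (b - a)) * F b = q - v \<bullet> y b"
    by (simp add: F_def mult.assoc[symmetric] exp_add[symmetric])
  finally show ?thesis by (simp add: F_def)
qed

section \<open>Averaging of past positions: the hull is invariant\<close>

text \<open>
  The averaging assumption replaces the equations of motion by the only consequence of them that
  is needed for invariance: if a half space \<open>{y. v \<bullet> y \<le> G}\<close> contains the recent past of all
  particles, then the outward speed of a particle is at most \<open>K\<close> times its distance to the
  bounding hyperplane. This holds whenever the velocity is a nonnegative combination, of total
  weight at most \<open>K\<close>, of differences between past positions and the current one.
\<close>

locale delayed_averaging =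
  fixes N :: nat and T K :: real and x :: "nat \<Rightarrow> real \<Rightarrow> 'a::euclidean_space"
  assumes T_pos: "T > 0" and K_pos: "K > 0"
    and cont: "\<And>i. i \<le> N \<Longrightarrow> continuous_on {-T..} (x i)"
    and locally_AC: "\<And>i. i \<le> N \<Longrightarrow> locally_abs_continuous_on {0..} (x i)"
    and averaging: "AE t in lebesgue. t \<ge> 0 \<longrightarrow> (\<forall>i\<le>N. \<exists>D. (x i has_vector_derivative D) (at t) \<and>
      (\<forall>v G. (\<forall>j\<le>N. \<forall>s\<in>{t-T..t}. v \<bullet> x j s \<le> G) \<longrightarrow> v \<bullet> D \<le> K * (G - v \<bullet> x i t)))"
begin

definition window_below :: "'a \<Rightarrow> real \<Rightarrow> real \<Rightarrow> bool" where
  "window_below v G t \<longleftrightarrow> (\<forall>j\<le>N. \<forall>s\<in>{t-T..t}. v \<bullet> x j s \<le> G)"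

lemma comparison:
  assumes "i \<le> N" "0 \<le> t0" "t0 \<le> t1"
    and "AE t in lebesgue. t \<in> {t0..t1} \<longrightarrow>
        (\<exists>D. (x i has_vector_derivative D) (at t) \<and> v \<bullet> D \<le> K * (q - v \<bullet> x i t))"
  shows "exp (- K * (t1 - t0)) * (q - v \<bullet> x i t0) \<le> q - v \<bullet> x i t1"
proof (rule exponential_comparison_AE)
  show "abs_continuous_on_interval t0 t1 (x i)"
    using locally_AC[OF assms(1)] assms(2,3) unfolding locally_abs_continuous_on_def by auto
  show "continuous_on {t0..t1} (x i)"
    using cont[OF assms(1)] by (rule continuous_on_subset) (use assms(2) T_pos in auto)
qed (use assms K_pos in auto)

lemma comparison_below:
  assumes "i \<le> N" "0 \<le> t0" "t0 \<le> t1"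
    and "\<And>j s. j \<le> N \<Longrightarrow> t0 - T \<le> s \<Longrightarrow> s \<le> t1 \<Longrightarrow> v \<bullet> x j s \<le> G"
  shows "exp (- K * (t1 - t0)) * (G - v \<bullet> x i t0) \<le> G - v \<bullet> x i t1"
proof (rule comparison[OF assms(1-3)])
  show "AE t in lebesgue. t \<in> {t0..t1} \<longrightarrow>
        (\<exists>D. (x i has_vector_derivative D) (at t) \<and> v \<bullet> D \<le> K * (G - v \<bullet> x i t))"
    using averaging
  proof (eventually_elim, intro impI)
    fix t
    assume t: "t \<in> {t0..t1}" and avg_t: "t \<ge> 0 \<longrightarrow> (\<forall>i\<le>N. \<exists>D. (x i has_vector_derivative D) (at t) \<and>
      (\<forall>v G. (\<forall>j\<le>N. \<forall>s\<in>{t-T..t}. v \<bullet> x j s \<le> G) \<longrightarrow> v \<bullet> D \<le> K * (G - v \<bullet> x i t)))"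
    have "t \<ge> 0" using t \<open>0 \<le> t0\<close> by auto
    then obtain D where D: "(x i has_vector_derivative D) (at t)" and
      "\<forall>v G. (\<forall>j\<le>N. \<forall>s\<in>{t-T..t}. v \<bullet> x j s \<le> G) \<longrightarrow> v \<bullet> D \<le> K * (G - v \<bullet> x i t)"
      using avg_t \<open>i \<le> N\<close> by blast
    then have "(\<forall>j\<le>N. \<forall>s\<in>{t-T..t}. v \<bullet> x j s \<le> G) \<longrightarrow> v \<bullet> D \<le> K * (G - v \<bullet> x i t)" by blast
    moreover have "\<forall>j\<le>N. \<forall>s\<in>{t-T..t}. v \<bullet> x j s \<le> G"
      using t by (intro allI impI ballI assms(4)) auto
    ultimately show "\<exists>D. (x i has_vector_derivative D) (at t) \<and> v \<bullet> D \<le> K * (G - v \<bullet> x i t)"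
      using D by blast
  qed
qed

text \<open>
  Let \<open>H\<close> be the largest value that any projection attains up to time \<open>s\<close>. If it exceeded \<open>G\<close>, it
  would be attained after \<open>t0\<close>. But relative to the level \<open>H\<close> every gap decays at most
  exponentially, and at time \<open>t0\<close> it is at least \<open>H - G > 0\<close>; so \<open>H\<close> is never attained.
\<close>

lemma half_space_invariant:
  assumes below: "window_below v G t0" and "0 \<le> t0" "i \<le> N" "t0 - T \<le> s"
  shows "v \<bullet> x i s \<le> G"
proof (cases "s \<le> t0")
  case True
  then show ?thesis using assms by (auto simp: window_below_def)
next
  case False
  define V where "V = (\<Union>j\<in>{..N}. (\<lambda>r. v \<bullet> x j r) ` {t0-T..s})"
  have "compact V"
    unfolding V_def
  proof (intro compact_UN compact_continuous_image continuous_intros)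
    show "continuous_on {t0-T..s} (x j)" if "j \<in> {..N}" for j
      by (rule continuous_on_subset[OF cont]) (use that \<open>0 \<le> t0\<close> in auto)
  qed auto
  moreover have x_V: "v \<bullet> x j r \<in> V" if "j \<le> N" "t0 - T \<le> r" "r \<le> s" for j r
    unfolding V_def by (intro UN_I[of j] imageI) (use that in auto)
  then have "V \<noteq> {}" using \<open>i \<le> N\<close> \<open>t0 - T \<le> s\<close> by blast
  ultimately obtain H where "H \<in> V" and H: "\<And>h. h \<in> V \<Longrightarrow> h \<le> H"
    using compact_attains_sup by metis
  from \<open>H \<in> V\<close> obtain j r where j: "j \<le> N" "t0 - T \<le> r" "r \<le> s" "H = v \<bullet> x j r"
    by (auto simp: V_def)
  have "H \<le> G"
  proof (rule ccontr)
    assume "\<not> H \<le> G"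
    then have "t0 < r" using below j by (force simp: window_below_def)
    then have "exp (- K * (r - t0)) * (H - v \<bullet> x j t0) \<le> H - v \<bullet> x j r"
      using j \<open>0 \<le> t0\<close> by (intro comparison_below H x_V) auto
    moreover have "v \<bullet> x j t0 \<le> G" using below j T_pos by (auto simp: window_below_def)
    moreover have "0 < exp (- K * (r - t0)) * (H - v \<bullet> x j t0)"
      using \<open>v \<bullet> x j t0 \<le> G\<close> \<open>\<not> H \<le> G\<close> by (intro mult_pos_pos) auto
    ultimately show False using j(4) by linarith
  qed
  then show ?thesis using H[OF x_V[of i s]] \<open>i \<le> N\<close> \<open>t0 - T \<le> s\<close> by simp
qed

lemma norm_le_initial:
  assumes R: "\<And>j s. j \<le> N \<Longrightarrow> s \<in> {-T..0} \<Longrightarrow> norm (x j s) \<le> R" and "i \<le> N" "-T \<le> s"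
  shows "norm (x i s) \<le> R"
proof -
  have "window_below (sgn (x i s)) R 0"
    unfolding window_below_def
  proof (intro allI impI ballI)
    fix j r assume "j \<le> N" "r \<in> {0-T..0}"
    then have "norm (x j r) \<le> R" using R by simp
    moreover have "sgn (x i s) \<bullet> x j r \<le> norm (sgn (x i s)) * norm (x j r)"
      by (rule norm_cauchy_schwarz)
    moreover have "norm (sgn (x i s)) * norm (x j r) \<le> norm (x j r)"
      by (intro mult_left_le_one_le) (auto simp: norm_sgn)
    ultimately show "sgn (x i s) \<bullet> x j r \<le> R" by linarith
  qed
  from half_space_invariant[OF this _ assms(2), of s] assms(3)
  have "sgn (x i s) \<bullet> x i s \<le> R" by simp
  moreover have "sgn (x i s) \<bullet> x i s = norm (x i s)"
    by (simp add: sgn_div_norm dot_square_norm power2_eq_square divide_simps)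
  ultimately show ?thesis by simp
qed

lemma trajectories_bounded:
  obtains R where "R > 0" "\<And>j s. j \<le> N \<Longrightarrow> -T \<le> s \<Longrightarrow> norm (x j s) \<le> R"
proof -
  have "bounded (\<Union>j\<in>{..N}. x j ` {-T..0})"
  proof (intro bounded_UN finite_atMost ballI compact_imp_bounded compact_continuous_image compact_Icc)
    show "continuous_on {-T..0} (x j)" if "j \<in> {..N}" for j
      by (rule continuous_on_subset[OF cont]) (use that in auto)
  qed
  then obtain R where "R > 0" and R: "\<forall>y\<in>(\<Union>j\<in>{..N}. x j ` {-T..0}). norm y \<le> R"
    unfolding bounded_pos by (elim exE conjE) (rule that)
  have "norm (x j s) \<le> R" if "j \<le> N" "s \<in> {-T..0}" for j s
    by (rule R[rule_format], rule UN_I[of j]) (use that in auto)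
  with that[OF \<open>R > 0\<close>] norm_le_initial show thesis by blast
qed

end

section \<open>A leader that pulls everybody: the hull contracts\<close>

text \<open>
  Here \<open>\<kappa>\<close> bounds from below the weight with which an agent is attracted by the recent past
  of the leader. If the leader stayed at distance \<open>c\<close> inside the half space, this weight lowers
  the outward speed of the agents by \<open>\<kappa> c\<close>.
\<close>

locale delayed_leader_averaging = delayed_averaging +
  fixes \<kappa> :: real
  assumes \<kappa>: "0 < \<kappa>" "\<kappa> \<le> K"
    and pull: "AE t in lebesgue. t \<ge> 0 \<longrightarrow> (\<forall>i\<in>{1..N}. \<exists>D. (x i has_vector_derivative D) (at t) \<and>
      (\<forall>v G c. c \<ge> 0 \<longrightarrow> (\<forall>j\<le>N. \<forall>s\<in>{t-T..t}. v \<bullet> x j s \<le> G) \<longrightarrow> (\<forall>s\<in>{t-T..t}. v \<bullet> x 0 s \<le> G - c)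
        \<longrightarrow> v \<bullet> D \<le> K * (G - v \<bullet> x i t) - \<kappa> * c))"
begin

text \<open>
  Over three windows the gap of the leader keeps the factor \<open>exp (- 3 K T)\<close>; one window of
  attraction at rate \<open>K\<close> passes the fraction \<open>\<kappa> / K (1 - exp (- K T))\<close> of it on to the agents.
\<close>

definition gain :: real where
  "gain = \<kappa> / K * (1 - exp (- K * T)) * exp (- 3 * K * T)"

lemma gain_bounds: "0 < gain" "gain < 1" "gain \<le> exp (- 3 * K * T)"
proof -
  have *: "0 < 1 - exp (- K * T)" "1 - exp (- K * T) < 1" "0 < \<kappa> / K" "\<kappa> / K \<le> 1" "exp (- 3 * K * T) < 1"
    using mult_pos_pos[OF K_pos T_pos] K_pos \<kappa> by (simp_all add: mult.assoc)
  then show "0 < gain" unfolding gain_def by (intro mult_pos_pos) auto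
  have "\<kappa> / K * (1 - exp (- K * T)) \<le> 1 * 1" using * by (intro mult_mono) auto
  then have "gain \<le> 1 * exp (- 3 * K * T)" unfolding gain_def by (intro mult_right_mono) auto
  then show "gain \<le> exp (- 3 * K * T)" by simp
  then show "gain < 1" using * by linarith
qed

text \<open>
  The agents solve the same comparison problem as before, with the level \<open>G\<close> lowered to
  \<open>q = G - \<kappa> c / K\<close>, once their delay window lies after \<open>t0\<close>, that is, from \<open>t0 + T\<close> on.
\<close>

lemma leader_gap_spreads:
  assumes below: "window_below v G t0" and "0 \<le> t0" and gap: "v \<bullet> x 0 t0 \<le> G - d" and "d \<ge> 0"
  shows "window_below v (G - gain * d) (t0 + 3 * T)"
proof -
  have inv: "v \<bullet> x j s \<le> G" if "j \<le> N" "t0 - T \<le> s" for j s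
    using half_space_invariant[OF below \<open>0 \<le> t0\<close>] that by blast
  \<comment> \<open>A lower bound for the gap of the leader during all three windows.\<close>
  define c where "c = exp (- 3 * K * T) * d"
  have "c \<ge> 0" using \<open>d \<ge> 0\<close> by (simp add: c_def)
  have leader: "v \<bullet> x 0 t \<le> G - c" if "t0 \<le> t" "t \<le> t0 + 3 * T" for t
  proof -
    have "exp (- K * (t - t0)) * (G - v \<bullet> x 0 t0) \<le> G - v \<bullet> x 0 t"
      using that \<open>0 \<le> t0\<close> by (intro comparison_below inv) auto
    moreover have "c \<le> exp (- K * (t - t0)) * (G - v \<bullet> x 0 t0)"
      unfolding c_def using that K_pos gap \<open>d \<ge> 0\<close> by (intro mult_mono) auto
    ultimately show ?thesis by linarith
  qed
  define w where "w = \<kappa> * c / K"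
  define q where "q = G - w"
  have agent: "v \<bullet> x i t \<le> G - gain * d" if i: "i \<in> {1..N}" and t: "t0 + 2 * T \<le> t" "t \<le> t0 + 3 * T" for i t
  proof -
    define e1 where "e1 = exp (- K * (t - (t0 + T)))"
    \<comment> \<open>At time \<open>t0 + T\<close> an agent may be above the level \<open>q\<close>, but by at most \<open>w\<close>; this excess decays during one window.\<close>
    have "e1 * (q - v \<bullet> x i (t0 + T)) \<le> q - v \<bullet> x i t"
      unfolding e1_def
    proof (rule comparison)
      show "AE r in lebesgue. r \<in> {t0 + T..t} \<longrightarrow>
          (\<exists>D. (x i has_vector_derivative D) (at r) \<and> v \<bullet> D \<le> K * (q - v \<bullet> x i r))"
        using pull
      proof (eventually_elim, intro impI)
        fix r
        assume r: "r \<in> {t0 + T..t}" and pull_r: "r \<ge> 0 \<longrightarrow> (\<forall>i\<in>{1..N}. \<exists>D. (x i has_vector_derivative D) (at r) \<and>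
          (\<forall>v G c. c \<ge> 0 \<longrightarrow> (\<forall>j\<le>N. \<forall>s\<in>{r-T..r}. v \<bullet> x j s \<le> G) \<longrightarrow> (\<forall>s\<in>{r-T..r}. v \<bullet> x 0 s \<le> G - c)
            \<longrightarrow> v \<bullet> D \<le> K * (G - v \<bullet> x i r) - \<kappa> * c))"
        have "r \<ge> 0" using r \<open>0 \<le> t0\<close> T_pos by auto
        then obtain D where D: "(x i has_vector_derivative D) (at r)" and
          "\<forall>v G c. c \<ge> 0 \<longrightarrow> (\<forall>j\<le>N. \<forall>s\<in>{r-T..r}. v \<bullet> x j s \<le> G) \<longrightarrow> (\<forall>s\<in>{r-T..r}. v \<bullet> x 0 s \<le> G - c)
            \<longrightarrow> v \<bullet> D \<le> K * (G - v \<bullet> x i r) - \<kappa> * c"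
          using pull_r i by blast
        then have D_le: "c \<ge> 0 \<longrightarrow> (\<forall>j\<le>N. \<forall>s\<in>{r-T..r}. v \<bullet> x j s \<le> G) \<longrightarrow> (\<forall>s\<in>{r-T..r}. v \<bullet> x 0 s \<le> G - c)
            \<longrightarrow> v \<bullet> D \<le> K * (G - v \<bullet> x i r) - \<kappa> * c"
          by blast
        have "\<forall>j\<le>N. \<forall>s\<in>{r-T..r}. v \<bullet> x j s \<le> G" "\<forall>s\<in>{r-T..r}. v \<bullet> x 0 s \<le> G - c"
          using r t T_pos by (auto intro!: inv leader)
        then have "v \<bullet> D \<le> K * (G - v \<bullet> x i r) - \<kappa> * c" using D_le \<open>c \<ge> 0\<close> by blast
        also have "\<dots> = K * (q - v \<bullet> x i r)" using K_pos by (simp add: q_def w_def right_diff_distrib)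
        finally show "\<exists>D. (x i has_vector_derivative D) (at r) \<and> v \<bullet> D \<le> K * (q - v \<bullet> x i r)"
          using D by blast
      qed
    qed (use i t \<open>0 \<le> t0\<close> T_pos in auto)
    moreover have "e1 * (- w) \<le> e1 * (q - v \<bullet> x i (t0 + T))"
    proof (rule mult_left_mono)
      have "v \<bullet> x i (t0 + T) \<le> G" using i T_pos by (intro inv) auto
      then show "- w \<le> q - v \<bullet> x i (t0 + T)" by (simp add: q_def)
    qed (simp add: e1_def)
    moreover have "e1 * w \<le> exp (- K * T) * w"
    proof (rule mult_right_mono)
      have "K * T \<le> K * (t - (t0 + T))" using t K_pos by (intro mult_left_mono) auto
      then show "e1 \<le> exp (- K * T)" by (simp add: e1_def)
    qed (use K_pos \<kappa> \<open>c \<ge> 0\<close> in \<open>simp add: w_def\<close>)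
    moreover have "gain * d = w - exp (- K * T) * w"
      by (simp add: gain_def c_def w_def left_diff_distrib right_diff_distrib mult_ac)
    ultimately show ?thesis unfolding q_def mult_minus_right by linarith
  qed
  have "gain * d \<le> c"
    unfolding c_def using gain_bounds(3) \<open>d \<ge> 0\<close> by (intro mult_right_mono) auto
  then have "v \<bullet> x j s \<le> G - gain * d" if "j \<le> N" "s \<in> {t0 + 3 * T - T..t0 + 3 * T}" for j s
    using agent[of j s] leader[of s] that T_pos by (cases "j = 0") auto
  then show ?thesis by (auto simp: window_below_def)
qed

definition window_spread :: "'a \<Rightarrow> real \<Rightarrow> real \<Rightarrow> bool" where
  "window_spread v \<Delta> t \<longleftrightarrow> (\<exists>m. window_below v (m + \<Delta>) t \<and> window_below (- v) (- m) t)"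

lemma window_below_next:
  assumes "window_below v G t" "0 \<le> t" "t \<le> t'"
  shows "window_below v G t'"
  unfolding window_below_def using half_space_invariant[OF assms(1,2)] assms(3) by auto

text \<open>
  By the symmetry \<open>v \<mapsto> - v\<close> the leader may be assumed in the half of the interval that lies
  away from the end that is to be moved; its gap is then at least \<open>\<Delta> / 2\<close>, and the other end
  stays where it is by invariance.
\<close>

lemma spread_contracts:
  assumes "window_spread v \<Delta> t" "0 \<le> t"
  shows "window_spread v ((1 - gain / 2) * \<Delta>) (t + 3 * T)"
proof -
  obtain m where up: "window_below v (m + \<Delta>) t" and lo: "window_below (- v) (- m) t"
    using assms(1) by (auto simp: window_spread_def)
  have "v \<bullet> x 0 t \<le> m + \<Delta>" "- v \<bullet> x 0 t \<le> - m"
    using up lo T_pos by (auto simp: window_below_def)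
  then have "\<Delta> \<ge> 0" by simp
  show ?thesis
  proof (cases "v \<bullet> x 0 t \<le> m + \<Delta> / 2")
    case True
    then have "window_below v (m + \<Delta> - gain * (\<Delta> / 2)) (t + 3 * T)"
      using up \<open>\<Delta> \<ge> 0\<close> assms(2) by (intro leader_gap_spreads) auto
    moreover have "window_below (- v) (- m) (t + 3 * T)"
      using lo assms(2) T_pos by (intro window_below_next[OF lo]) auto
    ultimately show ?thesis
      unfolding window_spread_def by (intro exI[of _ m]) (simp add: algebra_simps)
  next
    case False
    then have "window_below (- v) (- m - gain * (\<Delta> / 2)) (t + 3 * T)"
      using lo \<open>\<Delta> \<ge> 0\<close> assms(2) by (intro leader_gap_spreads) auto
    moreover have "window_below v (m + \<Delta>) (t + 3 * T)"
      using lo assms(2) T_pos by (intro window_below_next[OF up]) auto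
    ultimately show ?thesis
      unfolding window_spread_def by (intro exI[of _ "m + gain * (\<Delta> / 2)"]) (simp add: algebra_simps)
  qed
qed

lemma spread_geometric:
  assumes "window_spread v \<Delta> 0"
  shows "window_spread v ((1 - gain / 2) ^ n * \<Delta>) (real n * (3 * T))"
proof (induction n)
  case (Suc n)
  then show ?case using spread_contracts[OF Suc] T_pos by (simp add: algebra_simps)
qed (use assms in simp)

lemma exponential_consensus:
  "\<exists>C>0. \<exists>k>0. \<forall>i\<le>N. \<forall>t\<ge>0. norm (x i t - x 0 t) \<le> C * exp (- k * t)"
proof -
  obtain R where "R > 0" and R: "\<And>j s. j \<le> N \<Longrightarrow> -T \<le> s \<Longrightarrow> norm (x j s) \<le> R"
    using trajectories_bounded by blast
  define \<rho> where "\<rho> = 1 - gain / 2"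
  have \<rho>: "0 < \<rho>" "\<rho> < 1" using gain_bounds by (auto simp: \<rho>_def)
  define k where "k = - ln \<rho> / (3 * T)"
  have "k > 0" using \<rho> T_pos unfolding k_def by (intro divide_pos_pos) auto
  have "norm (x i t - x 0 t) \<le> 2 * R / \<rho> * exp (- k * t)" if "i \<le> N" "t \<ge> 0" for i t
  proof -
    define v where "v = sgn (x i t - x 0 t)"
    \<comment> \<open>The number of complete contraction periods up to time \<open>t\<close>.\<close>
    define n where "n = nat \<lfloor>t / (3 * T)\<rfloor>"
    have n: "real n \<le> t / (3 * T)" "t / (3 * T) - 1 \<le> real n"
      using T_pos \<open>t \<ge> 0\<close> by (auto simp: n_def)
    have "\<bar>v \<bullet> x j s\<bar> \<le> R" if "j \<le> N" "s \<in> {-T..0}" for j s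
    proof -
      have "\<bar>v \<bullet> x j s\<bar> \<le> norm v * norm (x j s)" by (rule Cauchy_Schwarz_ineq2)
      also have "\<dots> \<le> norm (x j s)" by (intro mult_left_le_one_le) (auto simp: v_def norm_sgn)
      also have "\<dots> \<le> R" using that by (intro R) auto
      finally show ?thesis .
    qed
    then have "window_spread v (2 * R) 0"
      unfolding window_spread_def window_below_def by (intro exI[of _ "- R"]) (auto simp: abs_le_iff)
    then have "window_spread v (\<rho> ^ n * (2 * R)) (real n * (3 * T))"
      unfolding \<rho>_def by (rule spread_geometric)
    then obtain m where m: "window_below v (m + \<rho> ^ n * (2 * R)) (real n * (3 * T))"
        "window_below (- v) (- m) (real n * (3 * T))"
      by (auto simp: window_spread_def)
    have "real n * (3 * T) - T \<le> t" using n(1) T_pos by (simp add: field_simps)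
    then have "v \<bullet> x i t \<le> m + \<rho> ^ n * (2 * R)" "- v \<bullet> x 0 t \<le> - m"
      using half_space_invariant[OF m(1)] half_space_invariant[OF m(2)] \<open>i \<le> N\<close> T_pos by auto
    then have "v \<bullet> (x i t - x 0 t) \<le> \<rho> ^ n * (2 * R)" by (simp add: inner_diff_right)
    moreover have "v \<bullet> (x i t - x 0 t) = norm (x i t - x 0 t)"
      by (simp add: v_def sgn_div_norm dot_square_norm power2_eq_square divide_simps)
    moreover have "\<rho> ^ n \<le> exp (- k * t) / \<rho>"
    proof -
      have "\<rho> ^ n = exp (real n * ln \<rho>)" using \<rho> by (simp add: exp_of_nat_mult)
      also have "\<dots> \<le> exp ((t / (3 * T) - 1) * ln \<rho>)"
        using n(2) \<rho> by (simp add: mult_right_mono_neg)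
      also have "\<dots> = exp (- k * t) / \<rho>"
        using \<rho> by (simp add: k_def left_diff_distrib exp_diff)
      finally show ?thesis .
    qed
    then have "\<rho> ^ n * (2 * R) \<le> exp (- k * t) / \<rho> * (2 * R)"
      using \<open>R > 0\<close> by (intro mult_right_mono) auto
    ultimately have "norm (x i t - x 0 t) \<le> exp (- k * t) / \<rho> * (2 * R)" by linarith
    then show ?thesis by (simp add: mult_ac)
  qed
  moreover have "2 * R / \<rho> > 0" using \<rho> \<open>R > 0\<close> by simp
  ultimately show ?thesis using \<open>k > 0\<close> by blast
qed

end

section \<open>The distributed-delay system\<close>

lemma has_integral_reflected_window:
  fixes f :: "real \<Rightarrow> real"
  assumes "f integrable_on {0..c}"
  shows "((\<lambda>s. f (t - s)) has_integral integral {0..c} f) {t - c..t}"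
proof -
  have "(f has_integral integral {0..c} f) (cbox 0 c)" using assms by auto
  from has_integral_affinity[OF this, of "- 1" t] show ?thesis
    by (simp add: image_diff_atLeastAtMost[symmetric] algebra_simps)
qed

text \<open>
  A non-integrable \<open>f\<close> has integral \<open>0\<close>, so for \<open>J \<ge> 0\<close> the bound holds for it as well. This
  saves the integrability of the control and of the mutual interaction in every use where the
  bound is nonnegative.
\<close>

lemma inner_integral_le:
  fixes f :: "real \<Rightarrow> 'a::euclidean_space"
  assumes g: "(g has_integral J) S" and le: "\<And>s. s \<in> S \<Longrightarrow> v \<bullet> f s \<le> g s"
    and "f integrable_on S \<or> 0 \<le> J"
  shows "v \<bullet> integral S f \<le> J"
proof (cases "f integrable_on S")
  case True
  then have "((\<lambda>s. v \<bullet> f s) has_integral v \<bullet> integral S f) S"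
    using has_integral_linear[OF integrable_integral[OF True] bounded_linear_inner_right[of v]] by (simp add: o_def)
  then show ?thesis using g le by (rule has_integral_le)
next
  case False
  then show ?thesis using assms(3) by (simp add: not_integrable_integral)
qed

locale distributed_delay_system =
  fixes N :: nat and \<gamma> M T :: real and \<tau> \<beta> a \<phi> :: "real \<Rightarrow> real"
    and x :: "nat \<Rightarrow> real \<Rightarrow> real^'d" and p :: "real \<Rightarrow> nat"
  assumes N: "N \<ge> 1" and \<gamma>: "\<gamma> > 0" and M: "M > 0"
    and \<tau>: "\<And>t. t \<ge> 0 \<Longrightarrow> 0 < \<tau> t \<and> \<tau> t \<le> T"
    and mass_pos: "\<And>t. t \<ge> 0 \<Longrightarrow> delay_mass \<tau> \<beta> t > 0"
    and \<beta>_nonneg: "\<And>s. s \<in> {0..T} \<Longrightarrow> \<beta> s \<ge> 0"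
    and \<beta>_integrable: "\<beta> absolutely_integrable_on {0..T}"
    and a_unit: "\<And>s. s \<ge> 0 \<Longrightarrow> 0 \<le> a s \<and> a s \<le> 1"
    and \<phi>_unit: "\<And>s. s \<ge> 0 \<Longrightarrow> 0 < \<phi> s \<and> \<phi> s \<le> 1"
    and \<phi>_mono: "\<And>s s'. 0 \<le> s \<Longrightarrow> s \<le> s' \<Longrightarrow> \<phi> s' \<le> \<phi> s"
    and \<phi>_cont: "continuous_on {0..} \<phi>"
    and x_cont: "\<And>i. i \<le> N \<Longrightarrow> continuous_on {-T..} (x i)"
    and x_AC: "\<And>i. i \<le> N \<Longrightarrow> locally_abs_continuous_on {0..} (x i)"
    and p: "\<And>t. t \<ge> 0 \<Longrightarrow> p t \<in> {1..N}"
    and dynamics: "AE t in lebesgue. t \<ge> 0 \<longrightarrow>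
        (x 0 has_vector_derivative feedback_control N \<gamma> M \<tau> \<beta> \<phi> x p t) (at t) \<and>
        (\<forall>i\<in>{1..N}. (x i has_vector_derivative agent_rhs N \<gamma> \<tau> \<beta> a \<phi> x i t) (at t))"
begin

lemma T_pos: "T > 0"
  using \<tau>[of 0] by simp

lemma window_subset: "t \<ge> 0 \<Longrightarrow> {t - \<tau> t..t} \<subseteq> {t - T..t}"
  using \<tau>[of t] by auto

lemma weight_nonneg: "t \<ge> 0 \<Longrightarrow> s \<in> {t - \<tau> t..t} \<Longrightarrow> \<beta> (t - s) \<ge> 0"
  using \<tau>[of t] by (intro \<beta>_nonneg) auto

lemma weight_has_integral:
  assumes "t \<ge> 0"
  shows "((\<lambda>s. \<beta> (t - s)) has_integral delay_mass \<tau> \<beta> t) {t - \<tau> t..t}"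
  unfolding delay_mass_def
proof (rule has_integral_reflected_window)
  have "\<beta> integrable_on {0..T}"
    using \<beta>_integrable set_lebesgue_integral_eq_integral(1) by blast
  then show "\<beta> integrable_on {0..\<tau> t}"
    by (rule integrable_on_subinterval) (use \<tau>[OF assms] in auto)
qed

lemma weighted_integrable:
  fixes f :: "real \<Rightarrow> real^'d"
  assumes "t \<ge> 0" "continuous_on {t - \<tau> t..t} f"
  shows "(\<lambda>s. \<beta> (t - s) *\<^sub>R f s) integrable_on {t - \<tau> t..t}"
proof -
  have "(\<lambda>s. \<beta> (t - s)) absolutely_integrable_on {t - \<tau> t..t}"
    using weight_has_integral[OF assms(1)] weight_nonneg[OF assms(1)]
    by (intro nonnegative_absolutely_integrable_1) auto
  moreover have "bilinear (\<lambda>y (b::real). b *\<^sub>R (y::real^'d))"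
    by (auto simp: bilinear_def intro!: linearI simp: scaleR_add_left scaleR_add_right)
  moreover have "bounded (f ` {t - \<tau> t..t})"
    using assms(2) by (intro compact_imp_bounded compact_continuous_image) auto
  ultimately have "(\<lambda>s. \<beta> (t - s) *\<^sub>R f s) absolutely_integrable_on {t - \<tau> t..t}"
    using assms(2)
    by (intro absolutely_integrable_bounded_measurable_product[of "\<lambda>y b. b *\<^sub>R y"])
       (auto intro: continuous_imp_measurable_on_sets_lebesgue)
  then show ?thesis using set_lebesgue_integral_eq_integral(1) by blast
qed

lemma weighted_inner_integral_le:
  fixes f :: "real \<Rightarrow> real^'d"
  assumes t: "t \<ge> 0" and le: "\<And>s. s \<in> {t - \<tau> t..t} \<Longrightarrow> v \<bullet> f s \<le> \<beta> (t - s) * q"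
    and "f integrable_on {t - \<tau> t..t} \<or> 0 \<le> q"
  shows "v \<bullet> integral {t - \<tau> t..t} f \<le> delay_mass \<tau> \<beta> t * q"
proof (rule inner_integral_le)
  show "((\<lambda>s. \<beta> (t - s) * q) has_integral delay_mass \<tau> \<beta> t * q) {t - \<tau> t..t}"
    using weight_has_integral[OF t] by (rule has_integral_mult_left)
  show "f integrable_on {t - \<tau> t..t} \<or> 0 \<le> delay_mass \<tau> \<beta> t * q"
    using assms(3) mass_pos[OF t] by auto
qed (rule le)

lemma control_weight_bounds:
  assumes "t \<ge> 0"
  shows "0 \<le> control_weight N \<gamma> M \<phi> x p t s" "control_weight N \<gamma> M \<phi> x p t s \<le> 1 / (2 * real N)"
proof -
  define c1 where "c1 = \<phi> (norm (x (p t) s - x 0 t)) / real N"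
  define D where "D = \<gamma> * (\<Sum>j=1..N. norm (x j s - x 0 t))"
  have c1: "0 \<le> c1" "c1 \<le> 1 / real N"
    using \<phi>_unit[of "norm (x (p t) s - x 0 t)"] N by (auto simp: c1_def divide_right_mono)
  have "0 \<le> D" unfolding D_def using \<gamma> by (intro mult_nonneg_nonneg sum_nonneg) auto
  then have "0 \<le> 2 * M / D" using M by simp
  have eq: "control_weight N \<gamma> M \<phi> x p t s = 1 / 2 * (if D = 0 then c1 else min c1 (2 * M / D))"
    by (simp add: control_weight_def Let_def c1_def D_def)
  show "0 \<le> control_weight N \<gamma> M \<phi> x p t s" unfolding eq using c1 \<open>0 \<le> 2 * M / D\<close> by auto
  have "(if D = 0 then c1 else min c1 (2 * M / D)) \<le> 1 / real N" using c1 by auto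
  then show "control_weight N \<gamma> M \<phi> x p t s \<le> 1 / (2 * real N)" unfolding eq by simp
qed

text \<open>
  The control weight is at most \<open>1 / (2N)\<close>, so the \<open>N\<close> agents together attract the leader with
  total weight at most \<open>\<gamma> / 2\<close>.
\<close>

lemma leader_rate_le:
  assumes t: "t \<ge> 0" and below: "\<forall>j\<le>N. \<forall>s\<in>{t-T..t}. v \<bullet> x j s \<le> G"
  shows "v \<bullet> feedback_control N \<gamma> M \<tau> \<beta> \<phi> x p t \<le> \<gamma> * (G - v \<bullet> x 0 t)"
proof -
  define g where "g = G - v \<bullet> x 0 t"
  have "g \<ge> 0" using below t T_pos by (auto simp: g_def)
  let ?w = "control_weight N \<gamma> M \<phi> x p t"
  let ?f = "\<lambda>s. (\<beta> (t - s) * ?w s) *\<^sub>R (\<Sum>j=1..N. \<phi> (norm (x j s - x 0 t)) *\<^sub>R (x j s - x 0 t))"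
  have "v \<bullet> integral {t - \<tau> t..t} ?f \<le> delay_mass \<tau> \<beta> t * g"
  proof (rule weighted_inner_integral_le[OF t])
    fix s assume s: "s \<in> {t - \<tau> t..t}"
    have term_le: "\<phi> (norm (x j s - x 0 t)) * (v \<bullet> (x j s - x 0 t)) \<le> g" if "j \<in> {1..N}" for j
    proof -
      have "v \<bullet> (x j s - x 0 t) \<le> g"
        using below that s window_subset[OF t] by (auto simp: g_def inner_diff_right)
      then have "\<phi> (norm (x j s - x 0 t)) * (v \<bullet> (x j s - x 0 t)) \<le> \<phi> (norm (x j s - x 0 t)) * g"
        using \<phi>_unit[of "norm (x j s - x 0 t)"] by (intro mult_left_mono) auto
      also have "\<dots> \<le> 1 * g"
        using \<phi>_unit[of "norm (x j s - x 0 t)"] \<open>g \<ge> 0\<close> by (intro mult_right_mono) auto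
      finally show ?thesis by simp
    qed
    have "(\<Sum>j=1..N. \<phi> (norm (x j s - x 0 t)) * (v \<bullet> (x j s - x 0 t))) \<le> real N * g"
      using sum_bounded_above[of "{1..N}" _ g, OF term_le] by simp
    then have "?w s * (\<Sum>j=1..N. \<phi> (norm (x j s - x 0 t)) * (v \<bullet> (x j s - x 0 t))) \<le> ?w s * (real N * g)"
      using control_weight_bounds[OF t, of s] by (intro mult_left_mono) auto
    also have "\<dots> \<le> 1 / (2 * real N) * (real N * g)"
      using control_weight_bounds[OF t, of s] \<open>g \<ge> 0\<close> by (intro mult_right_mono) auto
    also have "\<dots> \<le> g" using N \<open>g \<ge> 0\<close> by simp
    finally have "\<beta> (t - s) * (?w s * (\<Sum>j=1..N. \<phi> (norm (x j s - x 0 t)) * (v \<bullet> (x j s - x 0 t)))) \<le> \<beta> (t - s) * g"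
      using weight_nonneg[OF t s] by (intro mult_left_mono) auto
    then show "v \<bullet> ?f s \<le> \<beta> (t - s) * g" by (simp add: inner_sum_right mult.assoc)
  qed (use \<open>g \<ge> 0\<close> in auto)
  then have "\<gamma> / delay_mass \<tau> \<beta> t * (v \<bullet> integral {t - \<tau> t..t} ?f) \<le> \<gamma> / delay_mass \<tau> \<beta> t * (delay_mass \<tau> \<beta> t * g)"
    using \<gamma> mass_pos[OF t] by (intro mult_left_mono) auto
  then show ?thesis using mass_pos[OF t] by (simp add: feedback_control_def g_def)
qed

text \<open>
  The other agents contribute at most \<open>G - v \<bullet> x\<^sub>i(t)\<close>, whatever they see of each other. In the
  leader term the gap \<open>c\<close> is weighted by \<open>\<phi> \<ge> \<mu>\<close>, which leaves the gain \<open>\<gamma> \<mu> c\<close>.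
\<close>

lemma agent_rate_le:
  assumes t: "t \<ge> 0" and i: "i \<in> {1..N}" and below: "\<forall>j\<le>N. \<forall>s\<in>{t-T..t}. v \<bullet> x j s \<le> G"
    and "c \<ge> 0" and leader: "\<forall>s\<in>{t-T..t}. v \<bullet> x 0 s \<le> G - c"
    and \<mu>: "\<And>s. s \<in> {t-T..t} \<Longrightarrow> \<mu> \<le> \<phi> (norm (x 0 s - x i t))"
  shows "v \<bullet> agent_rhs N \<gamma> \<tau> \<beta> a \<phi> x i t \<le> (1 + \<gamma>) * (G - v \<bullet> x i t) - \<gamma> * \<mu> * c"
proof -
  define g where "g = G - v \<bullet> x i t"
  have "g \<ge> 0" using below t i T_pos by (auto simp: g_def)
  let ?h = "delay_mass \<tau> \<beta> t"
  let ?f = "\<lambda>j s. (\<beta> (t - s) * a (norm (x j s - x i t))) *\<^sub>R (x j s - x i t)"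
  let ?l = "\<lambda>s. (\<beta> (t - s) * \<phi> (norm (x 0 s - x i t))) *\<^sub>R (x 0 s - x i t)"
  have peer: "v \<bullet> integral {t - \<tau> t..t} (?f j) \<le> ?h * g" if j: "j \<in> {1..N} - {i}" for j
  proof (rule weighted_inner_integral_le[OF t])
    fix s assume s: "s \<in> {t - \<tau> t..t}"
    have "v \<bullet> (x j s - x i t) \<le> g"
      using below j s window_subset[OF t] by (auto simp: g_def inner_diff_right)
    then have "a (norm (x j s - x i t)) * (v \<bullet> (x j s - x i t)) \<le> a (norm (x j s - x i t)) * g"
      using a_unit[of "norm (x j s - x i t)"] by (intro mult_left_mono) auto
    also have "\<dots> \<le> 1 * g"
      using a_unit[of "norm (x j s - x i t)"] \<open>g \<ge> 0\<close> by (intro mult_right_mono) auto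
    finally have "\<beta> (t - s) * (a (norm (x j s - x i t)) * (v \<bullet> (x j s - x i t))) \<le> \<beta> (t - s) * g"
      using weight_nonneg[OF t s] by (intro mult_left_mono) auto
    then show "v \<bullet> ?f j s \<le> \<beta> (t - s) * g" by (simp add: mult.assoc)
  qed (use \<open>g \<ge> 0\<close> in auto)
  have "(\<Sum>j\<in>{1..N} - {i}. v \<bullet> integral {t - \<tau> t..t} (?f j)) \<le> real (card ({1..N} - {i})) * (?h * g)"
    using sum_bounded_above[of "{1..N} - {i}" _ "?h * g", OF peer] by simp
  also have "\<dots> \<le> real N * (?h * g)"
    using i \<open>g \<ge> 0\<close> mass_pos[OF t] by (intro mult_right_mono) auto
  finally have "1 / (real N * ?h) * (v \<bullet> (\<Sum>j\<in>{1..N} - {i}. integral {t - \<tau> t..t} (?f j)))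
      \<le> 1 / (real N * ?h) * (real N * (?h * g))"
    unfolding inner_sum_right using mass_pos[OF t] by (intro mult_left_mono) auto
  then have peers: "1 / (real N * ?h) * (v \<bullet> (\<Sum>j\<in>{1..N} - {i}. integral {t - \<tau> t..t} (?f j))) \<le> g"
    using N mass_pos[OF t] by simp
  have "v \<bullet> integral {t - \<tau> t..t} ?l \<le> ?h * (g - \<mu> * c)"
  proof (rule weighted_inner_integral_le[OF t])
    fix s assume s: "s \<in> {t - \<tau> t..t}"
    then have s': "s \<in> {t - T..t}" using window_subset[OF t] by blast
    let ?\<phi> = "\<phi> (norm (x 0 s - x i t))"
    have "v \<bullet> (x 0 s - x i t) \<le> g - c"
      using leader s' by (force simp: g_def inner_diff_right)
    then have "?\<phi> * (v \<bullet> (x 0 s - x i t)) \<le> ?\<phi> * (g - c)"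
      using \<phi>_unit[of "norm (x 0 s - x i t)"] by (intro mult_left_mono) auto
    also have "\<dots> = ?\<phi> * g - ?\<phi> * c" by (rule right_diff_distrib)
    also have "\<dots> \<le> 1 * g - \<mu> * c"
      using \<phi>_unit[of "norm (x 0 s - x i t)"] \<open>g \<ge> 0\<close> \<open>c \<ge> 0\<close> \<mu>[OF s']
      by (intro diff_mono mult_right_mono) auto
    finally have "\<beta> (t - s) * (?\<phi> * (v \<bullet> (x 0 s - x i t))) \<le> \<beta> (t - s) * (g - \<mu> * c)"
      using weight_nonneg[OF t s] by (intro mult_left_mono) auto
    then show "v \<bullet> ?l s \<le> \<beta> (t - s) * (g - \<mu> * c)" by (simp add: mult.assoc)
  next
    have x0: "continuous_on {t - \<tau> t..t} (x 0)"
      by (rule continuous_on_subset[OF x_cont]) (use t \<tau>[OF t] in auto)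
    have "continuous_on {t - \<tau> t..t} (\<lambda>s. \<phi> (norm (x 0 s - x i t)) *\<^sub>R (x 0 s - x i t))"
      by (intro continuous_on_scaleR continuous_on_compose2[OF \<phi>_cont] continuous_intros x0) auto
    from weighted_integrable[OF t this]
    show "?l integrable_on {t - \<tau> t..t} \<or> 0 \<le> g - \<mu> * c" by simp
  qed
  then have "\<gamma> / ?h * (v \<bullet> integral {t - \<tau> t..t} ?l) \<le> \<gamma> / ?h * (?h * (g - \<mu> * c))"
    using \<gamma> mass_pos[OF t] by (intro mult_left_mono) auto
  also have "\<dots> = \<gamma> * (g - \<mu> * c)" using mass_pos[OF t] by simp
  finally have "v \<bullet> agent_rhs N \<gamma> \<tau> \<beta> a \<phi> x i t \<le> g + \<gamma> * (g - \<mu> * c)"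
    using peers by (simp add: agent_rhs_def inner_add_right)
  then show ?thesis by (simp add: g_def algebra_simps)
qed

sublocale averaging: delayed_averaging N T "1 + \<gamma>" x
proof
  show "AE t in lebesgue. t \<ge> 0 \<longrightarrow> (\<forall>i\<le>N. \<exists>D. (x i has_vector_derivative D) (at t) \<and>
      (\<forall>v G. (\<forall>j\<le>N. \<forall>s\<in>{t-T..t}. v \<bullet> x j s \<le> G) \<longrightarrow> v \<bullet> D \<le> (1 + \<gamma>) * (G - v \<bullet> x i t)))"
    using dynamics
  proof (eventually_elim, intro impI allI)
    fix t i
    assume dyn: "t \<ge> 0 \<longrightarrow> (x 0 has_vector_derivative feedback_control N \<gamma> M \<tau> \<beta> \<phi> x p t) (at t) \<and>
        (\<forall>i\<in>{1..N}. (x i has_vector_derivative agent_rhs N \<gamma> \<tau> \<beta> a \<phi> x i t) (at t))"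
      and t: "t \<ge> 0" and i: "i \<le> N"
    show "\<exists>D. (x i has_vector_derivative D) (at t) \<and>
      (\<forall>v G. (\<forall>j\<le>N. \<forall>s\<in>{t-T..t}. v \<bullet> x j s \<le> G) \<longrightarrow> v \<bullet> D \<le> (1 + \<gamma>) * (G - v \<bullet> x i t))"
    proof (cases "i = 0")
      case True
      have "v \<bullet> feedback_control N \<gamma> M \<tau> \<beta> \<phi> x p t \<le> (1 + \<gamma>) * (G - v \<bullet> x i t)"
        if below: "\<forall>j\<le>N. \<forall>s\<in>{t-T..t}. v \<bullet> x j s \<le> G" for v G
      proof -
        have "v \<bullet> x 0 t \<le> G" using below t T_pos by auto
        then have "\<gamma> * (G - v \<bullet> x 0 t) \<le> (1 + \<gamma>) * (G - v \<bullet> x 0 t)" by (intro mult_right_mono) auto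
        then show ?thesis using leader_rate_le[OF t below] True by simp
      qed
      then show ?thesis using dyn t True by blast
    next
      case False
      then have i': "i \<in> {1..N}" using i by simp
      have "v \<bullet> agent_rhs N \<gamma> \<tau> \<beta> a \<phi> x i t \<le> (1 + \<gamma>) * (G - v \<bullet> x i t)"
        if below: "\<forall>j\<le>N. \<forall>s\<in>{t-T..t}. v \<bullet> x j s \<le> G" for v G
      proof -
        have "0 \<le> \<phi> (norm (x 0 s - x i t))" for s
          using \<phi>_unit[of "norm (x 0 s - x i t)"] by auto
        then show ?thesis using agent_rate_le[OF t i' below, of 0 0] below by auto
      qed
      then show ?thesis using dyn t i' by blast
    qed
  qed
qed (use T_pos \<gamma> x_cont x_AC in auto)

lemma consensus:
  "\<exists>C>0. \<exists>k>0. \<forall>i\<le>N. \<forall>t\<ge>0. norm (x i t - x 0 t) \<le> C * exp (- k * t)"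
proof -
  \<comment> \<open>Invariance of the hull bounds all distances by \<open>2R\<close>, so that \<open>\<phi>\<close> stays above \<open>\<phi> (2R)\<close>.\<close>
  obtain R where "R > 0" and R: "\<And>j s. j \<le> N \<Longrightarrow> -T \<le> s \<Longrightarrow> norm (x j s) \<le> R"
    using averaging.trajectories_bounded by blast
  define \<mu> where "\<mu> = \<phi> (2 * R)"
  have \<mu>: "0 < \<mu>" "\<mu> \<le> 1" using \<phi>_unit[of "2 * R"] \<open>R > 0\<close> by (auto simp: \<mu>_def)
  have \<mu>_le: "\<mu> \<le> \<phi> (norm (x 0 s - x i t))" if "i \<le> N" "t \<ge> 0" "s \<in> {t-T..t}" for i t s
  proof -
    have "norm (x 0 s) \<le> R" "norm (x i t) \<le> R"
      using R that T_pos by auto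
    then have "norm (x 0 s - x i t) \<le> 2 * R" using norm_triangle_ineq4[of "x 0 s" "x i t"] by linarith
    then show ?thesis unfolding \<mu>_def by (intro \<phi>_mono) auto
  qed
  interpret delayed_leader_averaging N T "1 + \<gamma>" x "\<gamma> * \<mu>"
  proof
    show "0 < \<gamma> * \<mu>" using \<gamma> \<mu> by simp
    have "\<gamma> * \<mu> \<le> \<gamma> * 1" using \<gamma> \<mu> by (intro mult_left_mono) auto
    then show "\<gamma> * \<mu> \<le> 1 + \<gamma>" by simp
    show "AE t in lebesgue. t \<ge> 0 \<longrightarrow> (\<forall>i\<in>{1..N}. \<exists>D. (x i has_vector_derivative D) (at t) \<and>
      (\<forall>v G c. c \<ge> 0 \<longrightarrow> (\<forall>j\<le>N. \<forall>s\<in>{t-T..t}. v \<bullet> x j s \<le> G) \<longrightarrow> (\<forall>s\<in>{t-T..t}. v \<bullet> x 0 s \<le> G - c)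
        \<longrightarrow> v \<bullet> D \<le> (1 + \<gamma>) * (G - v \<bullet> x i t) - \<gamma> * \<mu> * c))"
      using dynamics
    proof (eventually_elim, intro impI ballI)
      fix t i
      assume dyn: "t \<ge> 0 \<longrightarrow> (x 0 has_vector_derivative feedback_control N \<gamma> M \<tau> \<beta> \<phi> x p t) (at t) \<and>
          (\<forall>i\<in>{1..N}. (x i has_vector_derivative agent_rhs N \<gamma> \<tau> \<beta> a \<phi> x i t) (at t))"
        and t: "t \<ge> 0" and i: "i \<in> {1..N}"
      have "v \<bullet> agent_rhs N \<gamma> \<tau> \<beta> a \<phi> x i t \<le> (1 + \<gamma>) * (G - v \<bullet> x i t) - \<gamma> * \<mu> * c"
        if "c \<ge> 0" "\<forall>j\<le>N. \<forall>s\<in>{t-T..t}. v \<bullet> x j s \<le> G" "\<forall>s\<in>{t-T..t}. v \<bullet> x 0 s \<le> G - c" for v G c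
        using i t that by (intro agent_rate_le \<mu>_le) auto
      then show "\<exists>D. (x i has_vector_derivative D) (at t) \<and>
          (\<forall>v G c. c \<ge> 0 \<longrightarrow> (\<forall>j\<le>N. \<forall>s\<in>{t-T..t}. v \<bullet> x j s \<le> G) \<longrightarrow> (\<forall>s\<in>{t-T..t}. v \<bullet> x 0 s \<le> G - c)
            \<longrightarrow> v \<bullet> D \<le> (1 + \<gamma>) * (G - v \<bullet> x i t) - \<gamma> * \<mu> * c)"
        using dyn t i by blast
    qed
  qed
  show ?thesis by (rule exponential_consensus)
qed

end

theorem theorem4p4:
  fixes N :: nat
    and \<gamma> M L \<delta> r taubar taustar B R R\<^sub>\<gamma> :: real
    and \<tau> \<beta> a \<phi> :: "real \<Rightarrow> real"
    and xinit x :: "nat \<Rightarrow> real \<Rightarrow> real^'d"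
    and u :: "real \<Rightarrow> real^'d"
    and p :: "real \<Rightarrow> nat"
  assumes N: "N \<ge> 1"
    and gamma_M: "\<gamma> > 0" "M > 0"
    and tau: "continuous_on {0..} \<tau>" "taubar > 0" "taustar > 0"
      "\<And>t. t \<ge> 0 \<Longrightarrow> taustar \<le> \<tau> t \<and> \<tau> t \<le> taubar"
    and beta: "\<And>s. s \<in> {0..taubar} \<Longrightarrow> \<beta> s \<ge> 0"
      "\<beta> absolutely_integrable_on {0..taubar}"
      "integral {0..taustar} \<beta> > 0"
    and a: "\<And>s. s \<ge> 0 \<Longrightarrow> a s \<ge> 0" "continuous_on {0..} a" "antimono_on {0..} a"
      "0 < \<delta>" "\<delta> < r"
      "\<And>s. s \<in> {0..\<delta>} \<Longrightarrow> a s = 1" "\<And>s. s \<ge> r \<Longrightarrow> a s = 0"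
    and phi: "\<And>s. s \<ge> 0 \<Longrightarrow> \<phi> s > 0" "antimono_on {0..} \<phi>"
      "L > 0" "L-lipschitz_on {0..} \<phi>" "\<phi> 0 = 1"
    and init: "\<And>i. i \<in> {0..N} \<Longrightarrow> continuous_on {-taubar..0} (xinit i)"
    and sol: "is_solution_D N \<gamma> \<tau> taubar \<beta> a \<phi> xinit u x"
    and sel: "farthest_agent_selection N x p"
    and control: "\<And>t. t \<ge> 0 \<Longrightarrow> u t = feedback_control N \<gamma> M \<tau> \<beta> \<phi> x p t"
    and B: "B = integral {0..taubar} \<beta>"
    and R: "R = (MAX i\<in>{0..N}. SUP s\<in>{-taubar..0}. norm (x i s))"
    and Rg: "R\<^sub>\<gamma> = \<gamma> * L * R + \<gamma> + 1"
    and small: "taubar < ln (1 + \<gamma> * \<phi> (2 * R) /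
        (4 * R\<^sub>\<gamma> * B * (1 + \<gamma>) + \<gamma> * \<phi> (2 * R) * B * (1 + 2 * \<gamma>)))"
  shows "\<exists>C>0. \<exists>K>0. \<forall>i\<in>{1..N}. \<forall>t\<ge>0. norm (x i t - x 0 t) \<le> C * exp (- K * t)"
proof -
  have x_props: "continuous_on {-taubar..} (x i)" "locally_abs_continuous_on {0..} (x i)" if "i \<le> N" for i
    using sol that unfolding is_solution_D_def by auto
  interpret distributed_delay_system N \<gamma> M taubar \<tau> \<beta> a \<phi> x p
  proof
    show "0 < \<tau> t \<and> \<tau> t \<le> taubar" if "t \<ge> 0" for t
      using tau(4)[OF that] tau(3) by auto
    show "0 < delay_mass \<tau> \<beta> t" if "t \<ge> 0" for t
    proof -
      have "\<beta> integrable_on {0..taubar}"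
        using beta(2) set_lebesgue_integral_eq_integral(1) by blast
      then have "\<beta> integrable_on {0..taustar}" "\<beta> integrable_on {0..\<tau> t}"
        using tau(3) tau(4)[OF that] by (auto intro: integrable_on_subinterval)
      then have "integral {0..taustar} \<beta> \<le> integral {0..\<tau> t} \<beta>"
        using tau(4)[OF that] by (intro integral_subset_le) (auto intro: beta(1))
      then show ?thesis using beta(3) by (simp add: delay_mass_def)
    qed
    show "0 \<le> a s \<and> a s \<le> 1" if "s \<ge> 0" for s
      using a(1)[OF that] monotone_onD[OF a(3), of 0 s] a(6)[of 0] a(4) that by auto
    show "0 < \<phi> s \<and> \<phi> s \<le> 1" if "s \<ge> 0" for s
      using phi(1)[OF that] monotone_onD[OF phi(2), of 0 s] phi(5) that by auto
    show "\<phi> s' \<le> \<phi> s" if "0 \<le> s" "s \<le> s'" for s s'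
      using monotone_onD[OF phi(2), of s s'] that by auto
    show "continuous_on {0..} \<phi>"
      by (rule lipschitz_on_continuous_on[OF phi(4)])
    show "p t \<in> {1..N}" if "t \<ge> 0" for t
      using sel that unfolding farthest_agent_selection_def by blast
    have "AE t in lebesgue. t \<ge> 0 \<longrightarrow> (x 0 has_vector_derivative u t) (at t) \<and>
        (\<forall>i\<in>{1..N}. (x i has_vector_derivative agent_rhs N \<gamma> \<tau> \<beta> a \<phi> x i t) (at t))"
      using sol unfolding is_solution_D_def by blast
    then show "AE t in lebesgue. t \<ge> 0 \<longrightarrow>
        (x 0 has_vector_derivative feedback_control N \<gamma> M \<tau> \<beta> \<phi> x p t) (at t) \<and>
        (\<forall>i\<in>{1..N}. (x i has_vector_derivative agent_rhs N \<gamma> \<tau> \<beta> a \<phi> x i t) (at t))"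
      by eventually_elim (simp add: control)
  qed (use N gamma_M beta(1,2) x_props in auto)
  show ?thesis using consensus by fastforce
qed

end
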